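(* Let $(\mathfrak g,B,S)$ be a quadratic Rota-Baxter Lie algebra of weight $-1$, let $\widetilde B=\mathrm{id}-B$, and let $((\mathfrak g_+\bowtie\mathfrak g_-,S'),\mathfrak g_+,\mathfrak g_-)$ be the Manin triple on $(\mathfrak g,B,S)$. Let $C:\mathfrak g_+\bowtie\mathfrak g_-\to\mathfrak g_+\bowtie\mathfrak g_-$ be given by $$C\big((B(x_1),\widetilde B(x_2))\big)=\big(B(B(x_1)+\widetilde B(x_2)),\ \widetilde B(B(x_1)+\widetilde B(x_2))\big),\qquad\forall x_1,x_2\in\mathfrak g,$$ let $\mathfrak g_1=\mathrm{Im}\,C$, and let $S_{\mathfrak g_1}$ be the restriction of $S'$ to $\mathfrak g_1\times\mathfrak g_1$. Define $B_1,\widetilde{B_1}:\mathfrak g_1\to\mathfrak g_1$ by $B_1((x,u))=C((x,0))$ and $\widetilde{B_1}((x,u))=C((0,u))$ for all $(x,u)\in\mathfrak g_1$. Then: (a) $(\mathfrak g_1,B_1,S_{\mathfrak g_1})$ is a quadratic Rota-Baxter Lie algebra of weight $-1$ that is quadratic Rota-Baxter isomorphic to $(\mathfrak g,B,S)$; (b) $(\mathfrak g_1,\widetilde{B_1},S_{\mathfrak g_1})$ is a quadratic Rota-Baxter Lie algebra of weight $-1$ that is quadratic Rota-Baxter isomorphic to $(\mathfrak g,\widetilde B,S)$.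
   Context: Lie algebras are over a field $\mathbb K$. A Rota-Baxter operator of weight $\lambda$ on a Lie algebra $\mathfrak g$ is a linear map $B:\mathfrak g\to\mathfrak g$ with $[B(x),B(y)]=B([B(x),y]+[x,B(y)]+\lambda[x,y])$. A quadratic Lie algebra $(\mathfrak g,S)$ is a Lie algebra with a nondegenerate symmetric bilinear form $S:\mathfrak g\times\mathfrak g\to\mathbb K$ satisfying $S([x,y],z)=S(x,[y,z])$. A quadratic Rota-Baxter Lie algebra of weight $\lambda$ is a triple $(\mathfrak g,B,S)$ with $B$ a Rota-Baxter operator of weight $\lambda$ on $\mathfrak g$, $(\mathfrak g,S)$ a quadratic Lie algebra, and $S(B(x),y)+S(x,B(y))+\lambda S(x,y)=0$ for all $x,y$. A quadratic Rota-Baxter Lie algebra isomorphism $f:(\mathfrak g,B,S)\to(\mathfrak g',B',S')$ is a bijective Lie algebra homomorphism with $f\circ B=B'\circ f$ and $S'(f(x),f(y))=S(x,y)$ for all $x,y$. For $(\mathfrak g,B)$ of weight $-1$ put $\widetilde B=\mathrm{id}-B$, $\mathfrak g_+=\mathrm{Im}\,B$, $\mathfrak g_-=\mathrm{Im}\,\widetilde B$, with the well-defined maps $B(x)\rhd\widetilde B(y)=\widetilde B([B(x),y])$ and $\widetilde B(x)\blacktriangleright B(y)=B([\widetilde B(x),y])$. The Lie algebra $\mathfrak g_+\bowtie\mathfrak g_-$ is the (external) vector space direct sum $\mathfrak g_+\oplus\mathfrak g_-$ with bracket $$[(x,u),(y,v)]_{\bowtie}=\big([x,y]+u\blacktriangleright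 y-v\blacktriangleright x,\ [u,v]+x\rhd v-y\rhd u\big).$$ The Manin triple on $(\mathfrak g,B,S)$ is $((\mathfrak g_+\bowtie\mathfrak g_-,S'),\mathfrak g_+,\mathfrak g_-)$, where $S'\big((B(x_1),\widetilde B(x_2)),(B(y_1),\widetilde B(y_2))\big)=S(B(x_1),y_2)+S(B(y_1),x_2)$ for $x_1,x_2,y_1,y_2\in\mathfrak g$. The map $C$ is an idempotent Lie algebra homomorphism, so $\mathfrak g_1$ is a Lie subalgebra. *)

theory Defs
  imports "HOL-Analysis.Product_Vector"
begin

text \<open>
  A Lie algebra over the field \<open>'k\<close> is carried by a linear subspace \<open>L\<close> of a vector space on a
  whole type (\<open>L = UNIV\<close> is allowed). Subspaces rather than types are needed because the images
  \<open>Im B\<close>, \<open>Im (id - B)\<close>, \<open>Im C\<close> are Lie algebras in their own right. Every operation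
  (bracket, operator, form) is a function on the ambient type of which only the values on the
  carrier matter, so restricting one to a smaller carrier leaves the function unchanged.
\<close>

definition linear_map_on ::
  "('k::field \<Rightarrow> 'a::ab_group_add \<Rightarrow> 'a) \<Rightarrow> 'a set \<Rightarrow> ('k \<Rightarrow> 'b::ab_group_add \<Rightarrow> 'b) \<Rightarrow>
    ('a \<Rightarrow> 'b) \<Rightarrow> bool"
  where "linear_map_on s L s' f \<longleftrightarrow>
    (\<forall>x\<in>L. \<forall>y\<in>L. f (x + y) = f x + f y) \<and> (\<forall>c. \<forall>x\<in>L. f (s c x) = s' c (f x))"

definition bilinear_map_on ::
  "('k::field \<Rightarrow> 'a::ab_group_add \<Rightarrow> 'a) \<Rightarrow> 'a set \<Rightarrow> ('k \<Rightarrow> 'b::ab_group_add \<Rightarrow> 'b) \<Rightarrow>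
    ('a \<Rightarrow> 'a \<Rightarrow> 'b) \<Rightarrow> bool"
  where "bilinear_map_on s L s' h \<longleftrightarrow>
    (\<forall>x\<in>L. linear_map_on s L s' (h x)) \<and> (\<forall>y\<in>L. linear_map_on s L s' (\<lambda>x. h x y))"

locale lie_algebra = vector_space s
  for s :: "'k::field \<Rightarrow> 'a::ab_group_add \<Rightarrow> 'a" +
  fixes L :: "'a set" and br :: "'a \<Rightarrow> 'a \<Rightarrow> 'a"
  assumes carrier_subspace: "subspace L"
    and br_closed: "x \<in> L \<Longrightarrow> y \<in> L \<Longrightarrow> br x y \<in> L"
    and br_bilinear: "bilinear_map_on s L s br"
    and br_alternating: "x \<in> L \<Longrightarrow> br x x = 0"
    and jacobi: "x \<in> L \<Longrightarrow> y \<in> L \<Longrightarrow> z \<in> L \<Longrightarrow>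
      br x (br y z) + br y (br z x) + br z (br x y) = 0"

locale rota_baxter_lie_algebra = lie_algebra s L br
  for s :: "'k::field \<Rightarrow> 'a::ab_group_add \<Rightarrow> 'a" and L br +
  fixes w :: 'k and B :: "'a \<Rightarrow> 'a"
  assumes B_closed: "x \<in> L \<Longrightarrow> B x \<in> L"
    and B_linear: "linear_map_on s L s B"
    and rota_baxter: "x \<in> L \<Longrightarrow> y \<in> L \<Longrightarrow>
      br (B x) (B y) = B (br (B x) y + br x (B y) + s w (br x y))"

locale quadratic_lie_algebra = lie_algebra s L br
  for s :: "'k::field \<Rightarrow> 'a::ab_group_add \<Rightarrow> 'a" and L br +
  fixes S :: "'a \<Rightarrow> 'a \<Rightarrow> 'k"
  assumes S_bilinear: "bilinear_map_on s L (*) S"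
    and S_symmetric: "x \<in> L \<Longrightarrow> y \<in> L \<Longrightarrow> S x y = S y x"
    and S_nondegenerate: "x \<in> L \<Longrightarrow> (\<And>y. y \<in> L \<Longrightarrow> S x y = 0) \<Longrightarrow> x = 0"
    and S_invariant: "x \<in> L \<Longrightarrow> y \<in> L \<Longrightarrow> z \<in> L \<Longrightarrow> S (br x y) z = S x (br y z)"

locale quadratic_rota_baxter_lie_algebra =
  rota_baxter_lie_algebra s L br w B + quadratic_lie_algebra s L br S
  for s :: "'k::field \<Rightarrow> 'a::ab_group_add \<Rightarrow> 'a" and L br w B S +
  assumes S_rota_baxter: "x \<in> L \<Longrightarrow> y \<in> L \<Longrightarrow> S (B x) y + S x (B y) + w * S x y = 0"

locale quadratic_rota_baxter_iso =
  src: quadratic_rota_baxter_lie_algebra s L br w B S +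
  tgt: quadratic_rota_baxter_lie_algebra s' L' br' w B' S'
  for s :: "'k::field \<Rightarrow> 'a::ab_group_add \<Rightarrow> 'a" and L br
    and s' :: "'k \<Rightarrow> 'b::ab_group_add \<Rightarrow> 'b" and L' br' and w B S B' S' +
  fixes f :: "'a \<Rightarrow> 'b"
  assumes f_bij: "bij_betw f L L'"
    and f_linear: "linear_map_on s L s' f"
    and f_br: "x \<in> L \<Longrightarrow> y \<in> L \<Longrightarrow> f (br x y) = br' (f x) (f y)"
    and f_B: "x \<in> L \<Longrightarrow> f (B x) = B' (f x)"
    and f_S: "x \<in> L \<Longrightarrow> y \<in> L \<Longrightarrow> S' (f x) (f y) = S x y"

definition quadratic_rota_baxter_isomorphic ::
  "('k::field \<Rightarrow> 'a::ab_group_add \<Rightarrow> 'a) \<Rightarrow> 'a set \<Rightarrow> ('a \<Rightarrow> 'a \<Rightarrow> 'a) \<Rightarrow>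
    ('k \<Rightarrow> 'b::ab_group_add \<Rightarrow> 'b) \<Rightarrow> 'b set \<Rightarrow> ('b \<Rightarrow> 'b \<Rightarrow> 'b) \<Rightarrow>
    'k \<Rightarrow> ('a \<Rightarrow> 'a) \<Rightarrow> ('a \<Rightarrow> 'a \<Rightarrow> 'k) \<Rightarrow> ('b \<Rightarrow> 'b) \<Rightarrow> ('b \<Rightarrow> 'b \<Rightarrow> 'k) \<Rightarrow> bool"
  where "quadratic_rota_baxter_isomorphic s L br s' L' br' w B S B' S' \<longleftrightarrow>
    (\<exists>f. quadratic_rota_baxter_iso s L br s' L' br' w B S B' S' f)"

definition rb_tilde :: "('a::ab_group_add \<Rightarrow> 'a) \<Rightarrow> 'a \<Rightarrow> 'a"
  where "rb_tilde B x = x - B x"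

definition rb_plus :: "'a set \<Rightarrow> ('a::ab_group_add \<Rightarrow> 'a) \<Rightarrow> 'a set"
  where "rb_plus L B = B ` L"

definition rb_minus :: "'a set \<Rightarrow> ('a::ab_group_add \<Rightarrow> 'a) \<Rightarrow> 'a set"
  where "rb_minus L B = rb_tilde B ` L"

text \<open>
  The next two maps and the form \<open>manin_form\<close> are specified on images \<open>B y\<close>, \<open>rb_tilde B y\<close> by
  means of a preimage \<open>y\<close>. The description operator picks the value shared by all preimages;
  lemmas \<open>rb_rhd_eq\<close>, \<open>rb_blacktri_eq\<close> and \<open>manin_form_eq\<close> below show that it is well defined.
\<close>

definition rb_rhd ::
  "'a set \<Rightarrow> ('a \<Rightarrow> 'a \<Rightarrow> 'a) \<Rightarrow> ('a::ab_group_add \<Rightarrow> 'a) \<Rightarrow> 'a \<Rightarrow> 'a \<Rightarrow> 'a"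
  where "rb_rhd L br B x v =
    (THE r. \<exists>y\<in>L. v = rb_tilde B y \<and> r = rb_tilde B (br x y))"

definition rb_blacktri ::
  "'a set \<Rightarrow> ('a \<Rightarrow> 'a \<Rightarrow> 'a) \<Rightarrow> ('a::ab_group_add \<Rightarrow> 'a) \<Rightarrow> 'a \<Rightarrow> 'a \<Rightarrow> 'a"
  where "rb_blacktri L br B u y = (THE r. \<exists>z\<in>L. y = B z \<and> r = B (br u z))"

definition bowtie_carrier :: "'a set \<Rightarrow> ('a::ab_group_add \<Rightarrow> 'a) \<Rightarrow> ('a \<times> 'a) set"
  where "bowtie_carrier L B = rb_plus L B \<times> rb_minus L B"

fun bowtie_br ::
  "'a set \<Rightarrow> ('a \<Rightarrow> 'a \<Rightarrow> 'a) \<Rightarrow> ('a::ab_group_add \<Rightarrow> 'a) \<Rightarrow> 'a \<times> 'a \<Rightarrow> 'a \<times> 'a \<Rightarrow> 'a \<times> 'a"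
  where "bowtie_br L br B (x, u) (y, v) =
    (br x y + rb_blacktri L br B u y - rb_blacktri L br B v x,
     br u v + rb_rhd L br B x v - rb_rhd L br B y u)"

fun manin_form ::
  "'a set \<Rightarrow> ('a::ab_group_add \<Rightarrow> 'a) \<Rightarrow> ('a \<Rightarrow> 'a \<Rightarrow> 'k::field) \<Rightarrow> 'a \<times> 'a \<Rightarrow> 'a \<times> 'a \<Rightarrow> 'k"
  where "manin_form L B S (x, u) (y, v) =
    (THE r. \<exists>x2\<in>L. \<exists>y2\<in>L. u = rb_tilde B x2 \<and> v = rb_tilde B y2 \<and> r = S x y2 + S y x2)"

text \<open>
  The value \<open>C (B x1, rb_tilde B x2)\<close> depends only on the two components \<open>x = B x1\<close> and
  \<open>u = rb_tilde B x2\<close>, so no preimages are needed.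
\<close>

fun manin_C :: "('a::ab_group_add \<Rightarrow> 'a) \<Rightarrow> 'a \<times> 'a \<Rightarrow> 'a \<times> 'a"
  where "manin_C B (x, u) = (B (x + u), rb_tilde B (x + u))"

definition manin_g1 :: "'a set \<Rightarrow> ('a::ab_group_add \<Rightarrow> 'a) \<Rightarrow> ('a \<times> 'a) set"
  where "manin_g1 L B = manin_C B ` bowtie_carrier L B"

fun manin_B1 :: "('a::ab_group_add \<Rightarrow> 'a) \<Rightarrow> 'a \<times> 'a \<Rightarrow> 'a \<times> 'a"
  where "manin_B1 B (x, u) = manin_C B (x, 0)"

fun manin_B1_tilde :: "('a::ab_group_add \<Rightarrow> 'a) \<Rightarrow> 'a \<times> 'a \<Rightarrow> 'a \<times> 'a"
  where "manin_B1_tilde B (x, u) = manin_C B (0, u)"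

context quadratic_rota_baxter_lie_algebra
begin

lemma br_add_l: "x \<in> L \<Longrightarrow> y \<in> L \<Longrightarrow> z \<in> L \<Longrightarrow> br (x + y) z = br x z + br y z"
  and br_add_r: "x \<in> L \<Longrightarrow> y \<in> L \<Longrightarrow> z \<in> L \<Longrightarrow> br z (x + y) = br z x + br z y"
  and br_scale_l: "x \<in> L \<Longrightarrow> z \<in> L \<Longrightarrow> br (s c x) z = s c (br x z)"
  and br_scale_r: "x \<in> L \<Longrightarrow> z \<in> L \<Longrightarrow> br z (s c x) = s c (br z x)"
  using br_bilinear by (auto simp: bilinear_map_on_def linear_map_on_def)

lemma S_add_l: "x \<in> L \<Longrightarrow> y \<in> L \<Longrightarrow> z \<in> L \<Longrightarrow> S (x + y) z = S x z + S y z"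
  and S_add_r: "x \<in> L \<Longrightarrow> y \<in> L \<Longrightarrow> z \<in> L \<Longrightarrow> S z (x + y) = S z x + S z y"
  and S_scale_l: "x \<in> L \<Longrightarrow> z \<in> L \<Longrightarrow> S (s c x) z = c * S x z"
  and S_scale_r: "x \<in> L \<Longrightarrow> z \<in> L \<Longrightarrow> S z (s c x) = c * S z x"
  using S_bilinear by (auto simp: bilinear_map_on_def linear_map_on_def)

lemma B_add: "x \<in> L \<Longrightarrow> y \<in> L \<Longrightarrow> B (x + y) = B x + B y"
  and B_scale: "x \<in> L \<Longrightarrow> B (s c x) = s c (B x)"
  using B_linear by (auto simp: linear_map_on_def)

lemmas L_add = subspace_add[OF carrier_subspace]
  and L_diff = subspace_diff[OF carrier_subspace]
  and L_scale = subspace_scale[OF carrier_subspace]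
  and L_0 = subspace_0[OF carrier_subspace]

lemma
  assumes "x \<in> L" "y \<in> L"
  shows B_diff: "B (x - y) = B x - B y"
    and br_diff_r: "z \<in> L \<Longrightarrow> br z (x - y) = br z x - br z y"
    and br_diff_l: "z \<in> L \<Longrightarrow> br (x - y) z = br x z - br y z"
    and S_diff_r: "z \<in> L \<Longrightarrow> S z (x - y) = S z x - S z y"
    and S_diff_l: "z \<in> L \<Longrightarrow> S (x - y) z = S x z - S y z"
  using B_add[OF L_diff[OF assms] assms(2)] br_add_r[OF L_diff[OF assms] assms(2)]
    br_add_l[OF L_diff[OF assms] assms(2)] S_add_r[OF L_diff[OF assms] assms(2)]
    S_add_l[OF L_diff[OF assms] assms(2)]
  by (simp_all only: diff_add_cancel add_diff_cancel)

lemma tilde_closed: "x \<in> L \<Longrightarrow> rb_tilde B x \<in> L"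
  by (simp add: rb_tilde_def L_diff B_closed)

lemma tilde_diff: "x \<in> L \<Longrightarrow> y \<in> L \<Longrightarrow> rb_tilde B (x - y) = rb_tilde B x - rb_tilde B y"
  by (simp add: rb_tilde_def B_diff)

end

lemma rota_baxter_minus_one:
  assumes "quadratic_rota_baxter_lie_algebra s L br (-1) B S" "x \<in> L" "y \<in> L"
  shows "br (B x) (B y) = B (br (B x) y) + B (br x (B y)) - B (br x y)"
proof -
  interpret quadratic_rota_baxter_lie_algebra s L br "-1" B S by fact
  show ?thesis using rota_baxter[of x y] assms
    by (simp add: B_diff B_add br_closed L_add B_closed)
qed

lemma rb_rhd_eq:
  assumes q: "quadratic_rota_baxter_lie_algebra s L br (-1) B S" and x: "x \<in> L" and y: "y \<in> L"
  shows "rb_rhd L br B (B x) (rb_tilde B y) = rb_tilde B (br (B x) y)"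
proof -
  interpret quadratic_rota_baxter_lie_algebra s L br "-1" B S by fact
  have "rb_tilde B (br (B x) z) = rb_tilde B (br (B x) y)"
    if z: "z \<in> L" "rb_tilde B y = rb_tilde B z" for z
  proof -
    define d where "d = z - y"
    have d: "d \<in> L" "B d = d" using z y tilde_diff[of z y]
      by (auto simp: d_def L_diff rb_tilde_def B_diff algebra_simps)
    have "rb_tilde B (br (B x) d) = 0"
      using rota_baxter_minus_one[OF q x d(1)] d by (simp add: rb_tilde_def)
    then show ?thesis using z y x by (simp add: d_def br_diff_r tilde_diff br_closed B_closed)
  qed
  with y show ?thesis unfolding rb_rhd_def by (intro the_equality) metis+
qed

lemma rb_blacktri_eq:
  assumes q: "quadratic_rota_baxter_lie_algebra s L br (-1) B S" and x: "x \<in> L" and y: "y \<in> L"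
  shows "rb_blacktri L br B (rb_tilde B x) (B y) = B (br (rb_tilde B x) y)"
proof -
  interpret quadratic_rota_baxter_lie_algebra s L br "-1" B S by fact
  have "B (br (rb_tilde B x) z) = B (br (rb_tilde B x) y)"
    if z: "z \<in> L" "B y = B z" for z
  proof -
    define d where "d = z - y"
    have d: "d \<in> L" "B d = 0" using z y by (auto simp: d_def L_diff B_diff)
    have 0: "br u 0 = 0" if "u \<in> L" for u using br_diff_r[of 0 0 u] that L_0 by simp
    have B0: "B 0 = 0" using B_diff[of 0 0] L_0 by simp
    have "B (br (rb_tilde B x) d) = 0"
      using rota_baxter_minus_one[OF q x d(1)] d x
      by (simp add: rb_tilde_def 0 B0 B_closed br_diff_l B_diff br_closed)
    then show ?thesis using z y x by (simp add: d_def br_diff_r B_diff br_closed tilde_closed)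
  qed
  with y show ?thesis unfolding rb_blacktri_def by (intro the_equality) metis+
qed

lemma manin_form_eq:
  assumes q: "quadratic_rota_baxter_lie_algebra s L br (-1) B S"
    and x: "x1 \<in> L" "x2 \<in> L" and y: "y1 \<in> L" "y2 \<in> L"
  shows "manin_form L B S (B x1, rb_tilde B x2) (B y1, rb_tilde B y2) = S (B x1) y2 + S (B y1) x2"
proof -
  interpret quadratic_rota_baxter_lie_algebra s L br "-1" B S by fact
  have *: "S (B a) b = S a (rb_tilde B b)" if "a \<in> L" "b \<in> L" for a b
  proof -
    have "S (B a) b = S a b - S a (B b)"
      using S_rota_baxter[OF that] by (simp add: eq_diff_eq)
    then show ?thesis using that by (simp add: rb_tilde_def S_diff_r B_closed)
  qed
  show ?thesis
    unfolding manin_form.simps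
  proof (rule the_equality)
    show "\<exists>x2'\<in>L. \<exists>y2'\<in>L. rb_tilde B x2 = rb_tilde B x2' \<and> rb_tilde B y2 = rb_tilde B y2' \<and>
      S (B x1) y2 + S (B y1) x2 = S (B x1) y2' + S (B y1) x2'"
      using x y by blast
  next
    fix r
    assume "\<exists>x2'\<in>L. \<exists>y2'\<in>L. rb_tilde B x2 = rb_tilde B x2' \<and> rb_tilde B y2 = rb_tilde B y2' \<and>
      r = S (B x1) y2' + S (B y1) x2'"
    then obtain x2' y2' where "x2' \<in> L" "y2' \<in> L"
      "rb_tilde B x2 = rb_tilde B x2'" "rb_tilde B y2 = rb_tilde B y2'"
      "r = S (B x1) y2' + S (B y1) x2'"
      by blast
    then show "r = S (B x1) y2 + S (B y1) x2"
      using *[of x1 y2] *[of y1 x2] *[of x1 y2'] *[of y1 x2'] x y by metis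
  qed
qed

lemma manin_C_eq:
  "manin_C B (B x1, rb_tilde B x2) = (B (B x1 + rb_tilde B x2), rb_tilde B (B x1 + rb_tilde B x2))"
  by simp

end

theory Submission
  imports Defs
begin

text \<open>
  Since \<open>x = B x + rb_tilde B x\<close>, the map \<open>\<phi> x = (B x, rb_tilde B x)\<close> embeds \<open>L\<close> in the direct sum
  of the two images, with left inverse the addition \<open>(x, u) \<mapsto> x + u\<close>. The map \<open>C\<close> is addition
  followed by \<open>\<phi>\<close>, and addition maps the carrier of the bowtie algebra onto \<open>L\<close>, so \<open>Im C\<close> is
  \<open>\<phi> ` L\<close> (\<open>manin_g1_eq_image\<close>).

  On this image every structure of the statement is the one of \<open>L\<close> carried over by \<open>\<phi>\<close>:
  \<^item> the bowtie bracket of \<open>\<phi> x\<close> and \<open>\<phi> y\<close> is \<open>\<phi> (br x y)\<close>; in each component this is the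
    Rota-Baxter identity of weight \<open>-1\<close>, for \<open>B\<close> and for \<open>rb_tilde B\<close> respectively;
  \<^item> the Manin form of \<open>\<phi> x\<close> and \<open>\<phi> y\<close> is \<open>S (B x) y + S (B y) x\<close>, which is \<open>S x y\<close> because \<open>S\<close>
    is symmetric and compatible with \<open>B\<close> at weight \<open>-1\<close>;
  \<^item> \<open>B\<^sub>1 (\<phi> x) = C (B x, 0) = \<phi> (B x)\<close>, and likewise for the complementary operator.

  Hence addition is an isomorphism onto \<open>L\<close>, with \<open>B\<close> in part (a) and with \<open>rb_tilde B\<close>, again
  a Rota-Baxter operator of weight \<open>-1\<close> compatible with \<open>S\<close>, in part (b). All axioms for \<open>Im C\<close>
  then follow by transport of structure (\<open>quadratic_rota_baxter_transport\<close>).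
\<close>

text \<open>
  Transport of structure along an embedding \<open>\<phi>\<close> with left inverse \<open>f\<close>. The operations on the target
  are constrained only on the image of \<open>\<phi>\<close>, where each axiom is the corresponding axiom of the
  source read through \<open>\<phi>\<close>; nondegeneracy survives because the orthogonality is tested on that
  image alone.
\<close>

lemma quadratic_rota_baxter_transport:
  fixes s :: "'k::field \<Rightarrow> 'a::ab_group_add \<Rightarrow> 'a" and s' :: "'k \<Rightarrow> 'b::ab_group_add \<Rightarrow> 'b"
  assumes q: "quadratic_rota_baxter_lie_algebra s L br w B S"
    and vs: "vector_space s'"
    and lin: "linear_map_on s L s' \<phi>"
    and inv: "\<And>x. x \<in> L \<Longrightarrow> f (\<phi> x) = x"
    and br': "\<And>x y. x \<in> L \<Longrightarrow> y \<in> L \<Longrightarrow> br' (\<phi> x) (\<phi> y) = \<phi> (br x y)"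
    and B': "\<And>x. x \<in> L \<Longrightarrow> B' (\<phi> x) = \<phi> (B x)"
    and S': "\<And>x y. x \<in> L \<Longrightarrow> y \<in> L \<Longrightarrow> S' (\<phi> x) (\<phi> y) = S x y"
  shows "quadratic_rota_baxter_iso s' (\<phi> ` L) br' s L br w B' S' B S f"
proof -
  interpret quadratic_rota_baxter_lie_algebra s L br w B S by fact
  interpret V': vector_space s' by fact
  have add: "\<phi> (x + y) = \<phi> x + \<phi> y" if "x \<in> L" "y \<in> L" for x y
    using lin that by (simp add: linear_map_on_def)
  have scale: "\<phi> (s c x) = s' c (\<phi> x)" if "x \<in> L" for c x
    using lin that by (simp add: linear_map_on_def)
  have zero: "\<phi> 0 = 0"
    using add[of 0 0] L_0 by simp
  note closed = L_add L_scale br_closed B_closed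
  note fold = add[symmetric] scale[symmetric] closed br' B' S' inv
  have alg: "lie_algebra s' (\<phi> ` L) br'"
  proof
    show "V'.subspace (\<phi> ` L)"
    proof (rule V'.subspaceI)
      show "0 \<in> \<phi> ` L"
        using zero L_0 by (metis imageI)
    qed (auto simp: fold)
    show "bilinear_map_on s' (\<phi> ` L) s' br'"
      by (auto simp: bilinear_map_on_def linear_map_on_def fold br_add_l br_add_r br_scale_l
          br_scale_r)
  next
    fix x y z assume "x \<in> \<phi> ` L" "y \<in> \<phi> ` L" "z \<in> \<phi> ` L"
    then show "br' x (br' y z) + br' y (br' z x) + br' z (br' x y) = 0"
      by (auto simp: fold jacobi zero)
  qed (auto simp: fold br_alternating zero)
  interpret A': lie_algebra s' "\<phi> ` L" br' by (rule alg)
  interpret Q': quadratic_rota_baxter_lie_algebra s' "\<phi> ` L" br' w B' S'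
  proof
    show "linear_map_on s' (\<phi> ` L) s' B'"
      by (auto simp: linear_map_on_def fold B_add B_scale)
    show "bilinear_map_on s' (\<phi> ` L) (*) S'"
      by (auto simp: bilinear_map_on_def linear_map_on_def fold S_add_l S_add_r S_scale_l
          S_scale_r)
  next
    fix x y assume "x \<in> \<phi> ` L" "y \<in> \<phi> ` L"
    then show "br' (B' x) (B' y) = B' (br' (B' x) y + br' x (B' y) + s' w (br' x y))"
      by (auto simp: fold rota_baxter)
  next
    fix x assume "x \<in> \<phi> ` L" and ortho: "\<And>y. y \<in> \<phi> ` L \<Longrightarrow> S' x y = 0"
    then obtain a where a: "a \<in> L" "x = \<phi> a"
      by blast
    then have "a = 0"
      using ortho S' by (metis S_nondegenerate imageI)
    with a zero show "x = 0"
      by simp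
  next
    fix x y assume "x \<in> \<phi> ` L" "y \<in> \<phi> ` L"
    then show "S' x y = S' y x"
      using S_symmetric by (auto simp: fold)
  qed (auto simp: fold S_invariant S_rota_baxter)
  show ?thesis
  proof
    show "bij_betw f (\<phi> ` L) L"
      by (rule bij_betw_byWitness[where f' = \<phi>]) (auto simp: inv)
    show "linear_map_on s' (\<phi> ` L) s f"
      by (auto simp: linear_map_on_def fold)
  qed (auto simp: fold)
qed

text \<open>
  The two defining identities are symmetric under \<open>B \<mapsto> id - B\<close>: for the bracket, both sides of the
  Rota-Baxter identity for \<open>rb_tilde B\<close> expand to \<open>[x,y] - [Bx,y] - [x,By] + [Bx,By]\<close>.
\<close>

lemma quadratic_rota_baxter_tilde:
  assumes q: "quadratic_rota_baxter_lie_algebra s L br (-1) B S"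
  shows "quadratic_rota_baxter_lie_algebra s L br (-1) (rb_tilde B) S"
proof -
  interpret quadratic_rota_baxter_lie_algebra s L br "-1" B S by fact
  show ?thesis
  proof
    show "linear_map_on s L s (rb_tilde B)"
      by (simp add: linear_map_on_def rb_tilde_def B_add B_scale scale_right_diff_distrib)
  next
    fix x y assume "x \<in> L" "y \<in> L"
    then show "br (rb_tilde B x) (rb_tilde B y) =
        rb_tilde B (br (rb_tilde B x) y + br x (rb_tilde B y) + s (-1) (br x y))"
      by (simp add: rb_tilde_def rota_baxter_minus_one[OF q] B_closed br_closed L_add L_diff
          B_add B_diff br_diff_l br_diff_r)
  next
    fix x y assume "x \<in> L" "y \<in> L"
    then show "S (rb_tilde B x) y + S x (rb_tilde B y) + -1 * S x y = 0"
      using S_rota_baxter[of x y] by (simp add: rb_tilde_def B_closed S_diff_l S_diff_r algebra_simps)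
  qed (auto simp: tilde_closed)
qed

definition rb_split :: "('a::ab_group_add \<Rightarrow> 'a) \<Rightarrow> 'a \<Rightarrow> 'a \<times> 'a"
  where "rb_split B x = (B x, rb_tilde B x)"

lemma vector_space_prod_scale:
  assumes "vector_space s" "vector_space s'"
  shows "vector_space (module_prod.scale s s')"
proof -
  interpret vector_space_prod s s'
    using assms by (simp add: vector_space_prod_def vector_space_pair_def)
  show ?thesis by unfold_locales
qed

lemma linear_map_on_rb_split:
  assumes "quadratic_rota_baxter_lie_algebra s L br w B S"
  shows "linear_map_on s L (module_prod.scale s s) (rb_split B)"
proof -
  interpret quadratic_rota_baxter_lie_algebra s L br w B S by fact
  interpret module_prod s s by unfold_locales
  show ?thesis
    by (simp add: linear_map_on_def rb_split_def rb_tilde_def B_add B_scale scale_def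
        scale_right_diff_distrib)
qed

text \<open>
  The sum of an element of \<open>Im B\<close> and one of \<open>Im (id - B)\<close> is an arbitrary element of \<open>L\<close>, as
  already the pairs \<open>rb_split B x\<close> show.
\<close>

lemma manin_g1_eq_image:
  assumes "quadratic_rota_baxter_lie_algebra s L br w B S"
  shows "manin_g1 L B = rb_split B ` L"
proof -
  interpret quadratic_rota_baxter_lie_algebra s L br w B S by fact
  have "(\<lambda>(x, u). x + u) ` bowtie_carrier L B = L"
  proof
    show "(\<lambda>(x, u). x + u) ` bowtie_carrier L B \<subseteq> L"
      by (auto simp: bowtie_carrier_def rb_plus_def rb_minus_def L_add B_closed tilde_closed)
    show "L \<subseteq> (\<lambda>(x, u). x + u) ` bowtie_carrier L B"
    proof
      fix x assume "x \<in> L"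
      then have "(B x, rb_tilde B x) \<in> bowtie_carrier L B"
        by (simp add: bowtie_carrier_def rb_plus_def rb_minus_def)
      then show "x \<in> (\<lambda>(x, u). x + u) ` bowtie_carrier L B"
        by (force simp: rb_tilde_def)
    qed
  qed
  moreover have "manin_C B = rb_split B \<circ> (\<lambda>(x, u). x + u)"
    by (auto simp: fun_eq_iff rb_split_def)
  ultimately show ?thesis
    unfolding manin_g1_def by (metis image_comp)
qed

text \<open>
  Expand each bracket of images by the Rota-Baxter identity of the operator concerned; by
  antisymmetry of \<open>br\<close> the cross terms then cancel against the two mutual actions, leaving
  \<open>B [x,y]\<close> and \<open>rb_tilde B [x,y]\<close> in the two components.
\<close>

lemma bowtie_br_rb_split:
  assumes q: "quadratic_rota_baxter_lie_algebra s L br (-1) B S" and x: "x \<in> L" and y: "y \<in> L"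
  shows "bowtie_br L br B (rb_split B x) (rb_split B y) = rb_split B (br x y)"
proof -
  interpret quadratic_rota_baxter_lie_algebra s L br "-1" B S by fact
  have anti: "br b a = - br a b" if "a \<in> L" "b \<in> L" for a b
    using br_alternating[of "a + b"] br_alternating[of a] br_alternating[of b] that
    by (simp add: br_add_l br_add_r L_add eq_neg_iff_add_eq_0 add.commute)
  have neg: "B (- a) = - B a" if "a \<in> L" for a
    using B_diff[OF L_0 that] B_diff[OF L_0 L_0] by simp
  have "br (B x) (B y) + B (br (rb_tilde B x) y) - B (br (rb_tilde B y) x) = B (br x y)"
    using x y
    by (simp add: rota_baxter_minus_one[OF q] rb_tilde_def br_diff_l B_diff B_closed br_closed
        anti[of x y] anti[of x "B y"] neg)
  moreover have "br (rb_tilde B x) (rb_tilde B y) + rb_tilde B (br (B x) y)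
      - rb_tilde B (br (B y) x) = rb_tilde B (br x y)"
    using x y
    by (simp add: rota_baxter_minus_one[OF q] rb_tilde_def br_diff_l br_diff_r B_diff B_closed
        br_closed L_diff anti[of x "B y"] neg)
  ultimately show ?thesis
    using x y by (simp add: rb_split_def rb_rhd_eq[OF q] rb_blacktri_eq[OF q])
qed

lemma manin_form_rb_split:
  assumes q: "quadratic_rota_baxter_lie_algebra s L br (-1) B S" and x: "x \<in> L" and y: "y \<in> L"
  shows "manin_form L B S (rb_split B x) (rb_split B y) = S x y"
proof -
  interpret quadratic_rota_baxter_lie_algebra s L br "-1" B S by fact
  have "manin_form L B S (rb_split B x) (rb_split B y) = S (B x) y + S x (B y)"
    using x y S_symmetric[of "B y" x] by (simp add: rb_split_def manin_form_eq[OF q] B_closed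
        del: manin_form.simps)
  then show ?thesis
    using S_rota_baxter[OF x y] by simp
qed

text \<open>
  Both parts of the theorem are instances: the operators on \<open>Im C\<close> and on \<open>L\<close> only have to
  correspond under \<open>rb_split B\<close>, while bracket, form and embedding always stem from \<open>B\<close>.
\<close>

lemma manin_g1_isomorphic:
  assumes q: "quadratic_rota_baxter_lie_algebra s L br (-1) B S"
    and P: "quadratic_rota_baxter_lie_algebra s L br (-1) P S"
    and P': "\<And>x. x \<in> L \<Longrightarrow> P' (rb_split B x) = rb_split B (P x)"
  shows "quadratic_rota_baxter_lie_algebra (module_prod.scale s s) (manin_g1 L B)
        (bowtie_br L br B) (-1) P' (manin_form L B S)
      \<and> quadratic_rota_baxter_isomorphic (module_prod.scale s s) (manin_g1 L B)
        (bowtie_br L br B) s L br (-1) P' (manin_form L B S) P S"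
proof -
  interpret quadratic_rota_baxter_lie_algebra s L br "-1" B S by fact
  have "quadratic_rota_baxter_iso (module_prod.scale s s) (rb_split B ` L) (bowtie_br L br B)
      s L br (-1) P' (manin_form L B S) P S (\<lambda>(x, u). x + u)"
  proof (rule quadratic_rota_baxter_transport[OF P])
    show "vector_space (module_prod.scale s s)"
      by (intro vector_space_prod_scale vector_space_axioms)
    show "(\<lambda>(x, u). x + u) (rb_split B x) = x" for x
      by (simp add: rb_split_def rb_tilde_def)
  qed (use linear_map_on_rb_split[OF q] bowtie_br_rb_split[OF q] manin_form_rb_split[OF q] P'
      in auto)
  then show ?thesis
    unfolding manin_g1_eq_image[OF q] quadratic_rota_baxter_isomorphic_def
    by (blast dest: quadratic_rota_baxter_iso.axioms(1))
qed

theorem corollary3p12: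
  fixes s :: "'k::field \<Rightarrow> 'a::ab_group_add \<Rightarrow> 'a"
    and L :: "'a set"
    and br :: "'a \<Rightarrow> 'a \<Rightarrow> 'a"
    and B :: "'a \<Rightarrow> 'a"
    and S :: "'a \<Rightarrow> 'a \<Rightarrow> 'k"
  assumes "quadratic_rota_baxter_lie_algebra s L br (-1) B S"
  shows
    "(quadratic_rota_baxter_lie_algebra
        (module_prod.scale s s) (manin_g1 L B) (bowtie_br L br B) (-1)
        (manin_B1 B) (manin_form L B S)
      \<and> quadratic_rota_baxter_isomorphic
        (module_prod.scale s s) (manin_g1 L B) (bowtie_br L br B)
        s L br (-1)
        (manin_B1 B) (manin_form L B S) B S)
    \<and>
     (quadratic_rota_baxter_lie_algebra
        (module_prod.scale s s) (manin_g1 L B) (bowtie_br L br B) (-1)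
        (manin_B1_tilde B) (manin_form L B S)
      \<and> quadratic_rota_baxter_isomorphic
        (module_prod.scale s s) (manin_g1 L B) (bowtie_br L br B)
        s L br (-1)
        (manin_B1_tilde B) (manin_form L B S) (rb_tilde B) S)"
proof -
  have "manin_B1 B (rb_split B x) = rb_split B (B x)" for x
    by (simp add: rb_split_def)
  moreover have "manin_B1_tilde B (rb_split B x) = rb_split B (rb_tilde B x)" for x
    by (simp add: rb_split_def)
  ultimately show ?thesis
    using manin_g1_isomorphic[OF assms assms, of "manin_B1 B"]
      manin_g1_isomorphic[OF assms quadratic_rota_baxter_tilde[OF assms], of "manin_B1_tilde B"]
    by blast
qed

end
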